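(* Let $g\ge 0$, $n\ge 1$ be integers with $2g-2+n\ge 2$, and let $b\ge 0$ and $\mathbf b=(b_1,\dots,b_{n-1})$ with all $b_j\ge 0$. Then the super volume functions satisfy $$-\frac{1}{2}\Big((b+2\pi i)\widehat V_{g,n}(b+2\pi i,\mathbf b)+(b-2\pi i)\widehat V_{g,n}(b-2\pi i,\mathbf b)\Big)=\frac12\int_0^b b'(b-b')\widehat V_{g-1,n+1}(b',b-b',\mathbf b)\,db'$$ $$+\frac12\sum_{\substack{g_1+g_2=g\\ \mathbf b_1\sqcup\mathbf b_2=\mathbf b}}\int_0^b b'(b-b')\widehat V_{g_1,n_1}(b',\mathbf b_1)\widehat V_{g_2,n_2}(b-b',\mathbf b_2)\,db'$$ $$+\frac12\sum_{j=1}^{n-1}\Big((b+b_j)\widehat V_{g,n-1}(b+b_j,\mathbf b\setminus b_j)+(b-b_j)\widehat V_{g,n-1}(b-b_j,\mathbf b\setminus b_j)\Big).$$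
   Context: For $g\ge0$, $n\ge1$, $2g-2+n\ge1$, $\widehat V_{g,n}(b_1,\dots,b_n)$ denotes the super volume of the moduli space of super hyperbolic surfaces of genus $g$ with $n$ Neveu–Schwarz geodesic boundary components of lengths $b_1,\dots,b_n$, in Norbury's normalization $\widehat V_{g,n}=(-1)^n2^{g-1+n}V^{SW}_{g,n}$, where $V^{SW}$ is the Stanford–Witten super volume. One has $\widehat V_{0,n}=0$ for $n\ge 3$ and $\widehat V_{1,1}=\frac18$. It is known that $\widehat V_{g,n}$ is a symmetric polynomial, even in each variable (so it makes sense at complex arguments), and (Stanford–Witten) that for $2g-2+n\ge2$, $b,b_j\ge0$, $$2\pi b\,\widehat V_{g,n}(b,\mathbf b)=\frac12\int_0^\infty\!\!\int_0^\infty b'b''\widehat V_{g-1,n+1}(b',b'',\mathbf b)\widehat H(b'+b'',b)\,db'db''+\frac12\sum_{\substack{g_1+g_2=g\\ \mathbf b_1\sqcup\mathbf b_2=\mathbf b}}\int_0^\infty\!\!\int_0^\infty b'b''\widehat V_{g_1,n_1}(b',\mathbf b_1)\widehat V_{g_2,n_2}(b'',\mathbf b_2)\widehat H(b'+b'',b)\,db'db''+\frac12\sum_{j=1}^{n-1}\int_0^\infty b'\widehat V_{g,n-1}(b',\mathbf b\setminus b_j)\big(\widehat H(b',b+b_j)+\widehat H(b',b-b_j)\big)db',$$ with $\widehat H(x,y)=\frac12\left(\frac1{\cosh\frac{x-y}4}-\frac1{\cosh\frac{x+y}4}\right)$. Conventions: $\mathbf b\setminus b_j$ is $\mathbf b$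 with $b_j$ removed; the sum over $g_1+g_2=g$, $\mathbf b_1\sqcup\mathbf b_2=\mathbf b$ runs over ordered pairs of nonnegative integers and ordered set partitions, with $n_i=|\mathbf b_i|+1$; any term containing a $\widehat V_{g',n'}$ with $g'<0$ or $2g'-2+n'\le0$ is zero.
   Formalization: The leading factor -1/2 on the left is corrected to +1/2: with the printed sign the claim fails for g=1, n=2, b>0, where the recursion gives V_{1,2}=1/8, so the left side is -b/8 and the right side is b/8. *)

theory Defs
  imports "HOL-Analysis.Analysis" "HOL-Library.Multiset"
begin

text \<open>
  Functions of \<open>n\<close> complex variables are functions on lists of length \<open>n\<close>; \<open>c e\<close> is the coefficient
  of the monomial with exponent vector \<open>e\<close>.
\<close>

definition polynomial_fun :: "nat \<Rightarrow> (complex list \<Rightarrow> complex) \<Rightarrow> bool" where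
  "polynomial_fun n f \<longleftrightarrow>
     (\<exists>(S :: nat list set) (c :: nat list \<Rightarrow> complex).
        finite S \<and> (\<forall>e\<in>S. length e = n) \<and>
        (\<forall>xs. length xs = n \<longrightarrow> f xs = (\<Sum>e\<in>S. c e * (\<Prod>i<n. xs ! i ^ (e ! i)))))"

definition symmetric_fun :: "nat \<Rightarrow> (complex list \<Rightarrow> complex) \<Rightarrow> bool" where
  "symmetric_fun n f \<longleftrightarrow>
     (\<forall>xs ys. length xs = n \<and> mset xs = mset ys \<longrightarrow> f xs = f ys)"

definition even_fun :: "nat \<Rightarrow> (complex list \<Rightarrow> complex) \<Rightarrow> bool" where
  "even_fun n f \<longleftrightarrow>
     (\<forall>xs i. length xs = n \<and> i < n \<longrightarrow> f (xs[i := - (xs ! i)]) = f xs)"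

definition Hhat :: "real \<Rightarrow> real \<Rightarrow> real" where
  "Hhat x y = 1/2 * (1 / cosh ((x - y) / 4) - 1 / cosh ((x + y) / 4))"

text \<open>
  \<open>V g [b\<^sub>1, \<dots>, b\<^sub>n]\<close> is the super volume of genus \<open>g\<close> with \<open>n\<close> Neveu--Schwarz boundary components,
  in the normalisation \<open>(-1)^n 2^(g-1+n)\<close> times the Stanford--Witten volume.  The moduli space itself
  is not constructed: the family is given by the initial values, the structural properties and the
  Stanford--Witten recursion, which together determine \<open>V g xs\<close> for all nonempty \<open>xs\<close>.

  The genus is an integer, and \<open>V\<close> is extended by zero to negative genus and to the unstable range,
  so that the corresponding terms of the recursion vanish.

  An ordered partition of the boundary lengths \<open>bs\<close> into two parts is a set \<open>I\<close> of positions in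
  \<open>bs\<close>, with parts \<open>nths bs I\<close> and \<open>nths bs (- I)\<close>; thus equal lengths at different positions are
  distinguished.  Likewise \<open>nths bs (- {j})\<close> is \<open>bs\<close> with its entry at position \<open>j\<close> removed.

  In this normalisation all signs in the recursion are positive; for instance it gives
  \<open>V 1 [x, y] = 1/8\<close>.
\<close>

locale super_volumes =
  fixes V :: "int \<Rightarrow> complex list \<Rightarrow> complex"
  assumes unstable: "g < 0 \<or> 2 * g - 2 + int (length xs) \<le> 0 \<Longrightarrow> V g xs = 0"
    and genus_0: "length xs \<ge> 3 \<Longrightarrow> V 0 xs = 0"
    and genus_1: "V 1 [x] = 1/8"
    and polynomial:
      "0 \<le> g \<Longrightarrow> 1 \<le> n \<Longrightarrow> 2 * g - 2 + int n \<ge> 1 \<Longrightarrow> polynomial_fun n (V g)"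
    and symmetric:
      "0 \<le> g \<Longrightarrow> 1 \<le> n \<Longrightarrow> 2 * g - 2 + int n \<ge> 1 \<Longrightarrow> symmetric_fun n (V g)"
    and even:
      "0 \<le> g \<Longrightarrow> 1 \<le> n \<Longrightarrow> 2 * g - 2 + int n \<ge> 1 \<Longrightarrow> even_fun n (V g)"
    and recursion:
      "0 \<le> g \<Longrightarrow> 1 \<le> n \<Longrightarrow> 2 * g - 2 + int n \<ge> 2 \<Longrightarrow>
       0 \<le> b \<Longrightarrow> length bs = n - 1 \<Longrightarrow> \<forall>t\<in>set bs. 0 \<le> t \<Longrightarrow>
       complex_of_real (2 * pi * b) * V g (map complex_of_real (b # bs)) =
         1/2 * (LBINT x:{0..}. LBINT y:{0..}.
                  complex_of_real (x * y) * V (g - 1) (map complex_of_real (x # y # bs))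
                  * complex_of_real (Hhat (x + y) b))
       + 1/2 * (\<Sum>g1\<in>{0..g}. \<Sum>I\<in>Pow {..<n - 1}.
                  LBINT x:{0..}. LBINT y:{0..}.
                    complex_of_real (x * y)
                    * V g1 (map complex_of_real (x # nths bs I))
                    * V (g - g1) (map complex_of_real (y # nths bs (- I)))
                    * complex_of_real (Hhat (x + y) b))
       + 1/2 * (\<Sum>j<n - 1.
                  LBINT x:{0..}.
                    complex_of_real x * V g (map complex_of_real (x # nths bs (- {j})))
                    * complex_of_real (Hhat x (b + bs ! j) + Hhat x (b - bs ! j)))"

end

theory Submission
  imports Defs "HOL-Probability.Sinc_Integral" "HOL-Complex_Analysis.Complex_Analysis" "HOL-Real_Asymp.Real_Asymp"
begin

text \<open>
  For an odd polynomial \<open>p\<close>, unfolding the integral of \<open>p\<close> against \<open>Hhat x b\<close> from the half-line to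
  the whole line gives half of \<open>S p b = \<integral> p (b + u) / cosh (u / 4) du\<close>.  In a double integral, putting
  \<open>z = x + y\<close> and applying Fubini reduces the integrand to the convolution over \<open>0 \<le> x \<le> z\<close>, which is again an
  odd polynomial in \<open>z\<close>.  So the right-hand side of the recursion at \<open>b\<close> is \<open>S P b / 2\<close>, where
  \<open>P b\<close> is the right-hand side of the theorem, and both sides of the recursion are
  polynomials in \<open>b\<close>, hence agree at complex arguments.  Moving the line of integration by \<open>\<plusminus> 2 \<pi> \<i>\<close> turns
  \<open>1 / cosh\<close> into \<open>\<plusminus> \<i> / sinh\<close>, whose only pole in the strip between is at \<open>0\<close>, so
  \<open>S p (z + 2 \<pi> \<i>) + S p (z - 2 \<pi> \<i>) = 8 \<pi> p z\<close>; this undoes \<open>S\<close> and yields the theorem.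
\<close>

section \<open>Integrals against the hyperbolic secant\<close>

text \<open>Two copies of the Gamma integrand \<open>h\<close>, dilated by 1/4 and -1/4, cover the
  two half-lines and together dominate; the factor \<open>4 ^ k\<close> undoes the dilation of the
  power.\<close>

lemma integrable_power_exp_abs: "integrable lborel (\<lambda>u::real. \<bar>u\<bar> ^ k * exp (- \<bar>u\<bar> / 4))"
proof -
  define h :: "real \<Rightarrow> real" where "h = (\<lambda>x. x ^ k * exp (- x) * indicator {0..} x)"
  have h: "integrable lborel h"
    unfolding h_def using has_bochner_integral_I0i_power_exp_m' by (rule integrable.intros)
  have pos: "integrable lborel (\<lambda>u. h (0 + 1/4 * u))" and neg: "integrable lborel (\<lambda>u. h (0 + (-1/4) * u))"
    by (intro lborel_integrable_real_affine h; simp)+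
  have "integrable lborel (\<lambda>u. 4 ^ k * (h (0 + 1/4 * u) + h (0 + (-1/4) * u)))"
    using pos neg by (intro integrable_mult_right Bochner_Integration.integrable_add)
  then show ?thesis
  proof (rule Bochner_Integration.integrable_bound)
    show "AE u in lborel. norm (\<bar>u\<bar> ^ k * exp (- \<bar>u\<bar> / 4))
            \<le> norm (4 ^ k * (h (0 + 1/4 * u) + h (0 + (-1/4) * u)))"
    proof (intro AE_I2)
      fix u :: real
      have nonneg: "h x \<ge> 0" for x
        by (auto simp: h_def indicator_def)
      have "\<bar>u\<bar> ^ k * exp (- \<bar>u\<bar> / 4) = 4 ^ k * h (\<bar>u\<bar> / 4)"
        by (simp add: h_def power_divide)
      also have "\<dots> \<le> 4 ^ k * (h (0 + 1/4 * u) + h (0 + (-1/4) * u))"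
        using nonneg[of "u/4"] nonneg[of "-u/4"] by (cases "u \<ge> 0") auto
      finally show "norm (\<bar>u\<bar> ^ k * exp (- \<bar>u\<bar> / 4))
            \<le> norm (4 ^ k * (h (0 + 1/4 * u) + h (0 + (-1/4) * u)))"
        by simp
    qed
  qed simp
qed

lemma integrable_poly_exp_abs:
  "integrable lborel (\<lambda>u. poly p (complex_of_real u) * complex_of_real (exp (- \<bar>u\<bar> / 4)))"
proof -
  have "integrable lborel (\<lambda>u. complex_of_real u ^ i * complex_of_real (exp (- \<bar>u\<bar> / 4)))" for i
    by (rule Bochner_Integration.integrable_bound[OF integrable_power_exp_abs[of i]])
       (auto simp: norm_mult norm_power)
  then show ?thesis
    unfolding poly_altdef sum_distrib_right
    by (intro Bochner_Integration.integrable_sum) (simp add: mult.assoc)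
qed

definition sech4 :: "real \<Rightarrow> real" where "sech4 u = 1 / cosh (u / 4)"

lemma sech4_pos: "sech4 u > 0"
  by (simp add: sech4_def)

lemma sech4_minus [simp]: "sech4 (- u) = sech4 u"
  by (simp add: sech4_def)

lemma borel_measurable_sech4 [measurable]: "sech4 \<in> borel_measurable borel"
  unfolding sech4_def cosh_field_def by measurable

lemma sech4_le: "sech4 u \<le> 2 * exp (- \<bar>u\<bar> / 4)"
proof -
  have "exp (\<bar>u\<bar> / 4) \<le> 2 * cosh (u / 4)"
    by (cases "u \<ge> 0") (auto simp: cosh_field_def)
  then show ?thesis
    by (simp add: sech4_def exp_minus field_simps)
qed

lemma integrable_poly_sech4:
  "integrable lborel (\<lambda>u. poly p (complex_of_real u) * complex_of_real (sech4 u))"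
proof (rule Bochner_Integration.integrable_bound)
  show "integrable lborel (\<lambda>u. 2 * (poly p (complex_of_real u) * complex_of_real (exp (- \<bar>u\<bar> / 4))))"
    by (intro integrable_mult_right integrable_poly_exp_abs)
  have "(\<lambda>u. poly p (complex_of_real u)) \<in> borel_measurable borel"
    by (intro borel_measurable_continuous_onI continuous_intros)
  then show "(\<lambda>u. poly p (complex_of_real u) * complex_of_real (sech4 u)) \<in> borel_measurable lborel"
    by measurable
  show "AE u in lborel. norm (poly p (complex_of_real u) * complex_of_real (sech4 u))
     \<le> norm (2 * (poly p (complex_of_real u) * complex_of_real (exp (- \<bar>u\<bar> / 4))))"
  proof (intro AE_I2)
    fix u
    show "norm (poly p (complex_of_real u) * complex_of_real (sech4 u))
       \<le> norm (2 * (poly p (complex_of_real u) * complex_of_real (exp (- \<bar>u\<bar> / 4))))"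
      using mult_left_mono[OF sech4_le[of u], of "norm (poly p (complex_of_real u))"] sech4_pos[of u]
      by (simp add: norm_mult)
  qed
qed

lemma integrable_poly_sech4_shift:
  "integrable lborel (\<lambda>u. poly p (z + complex_of_real u) * complex_of_real (sech4 u))"
  using integrable_poly_sech4[of "pcompose p [:z, 1:]"] by (simp add: poly_pcompose)

text \<open>The primitive \<open>F\<close> is an arctangent of \<open>sinh\<close>, since 1 + sinh^2
  = cosh^2. This value is the source of every factor pi in the final identity.\<close>

lemma integral_sech4: "(LBINT u. sech4 u) = 4 * pi"
proof -
  define F where "F = (\<lambda>u::real. 4 * arctan (sinh (u / 4)))"
  have "(LBINT u=-\<infinity>..\<infinity>. sech4 u) = 2 * pi - (- (2 * pi))"
  proof (rule interval_integral_FTC_nonneg)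
    show "DERIV F u :> sech4 u" for u
    proof -
      have "1 + (sinh (u / 4))\<^sup>2 \<noteq> 0"
        by (simp add: add_nonneg_eq_0_iff)
      then show ?thesis
        using cosh_square_eq[of "u / 4"] unfolding F_def sech4_def
        by (auto intro!: derivative_eq_intros simp: power2_eq_square divide_simps)
    qed
    show "isCont sech4 u" for u
      unfolding sech4_def by (intro continuous_intros) auto
    have "filterlim (\<lambda>u::real. sinh (u/4)) at_top at_top" "filterlim (\<lambda>u::real. sinh (u/4)) at_bot at_bot"
      unfolding sinh_field_def by real_asymp+
    then have "(F \<longlongrightarrow> 4 * (pi / 2)) at_top" "(F \<longlongrightarrow> 4 * (- (pi / 2))) at_bot"
      unfolding F_def
      by - (rule tendsto_mult_left, rule filterlim_compose[OF tendsto_arctan_at_top], assumption,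
            rule tendsto_mult_left, rule filterlim_compose[OF tendsto_arctan_at_bot], assumption)
    then show "((F \<circ> real_of_ereal) \<longlongrightarrow> - (2*pi)) (at_right (-\<infinity>))" "((F \<circ> real_of_ereal) \<longlongrightarrow> 2 * pi) (at_left \<infinity>)"
      by (simp_all add: ereal_tendsto_simps)
  qed (auto simp: sech4_pos less_imp_le)
  then show ?thesis
    by (simp add: interval_lebesgue_integral_def set_lebesgue_integral_def)
qed

section \<open>The shift identity for the secant transform\<close>

text \<open>The zeros of \<open>sinh\<close> are the integer multiples of pi i, as seen from those
  of the sine.\<close>

lemma sinh_complex_zero:
  assumes "\<bar>Im z\<bar> < pi" "sinh z = 0"
  shows "z = 0"
proof -
  have "sin (\<i> * z) = 0"
    using assms(2) by (simp add: sinh_conv_sin)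
  then obtain n :: int where n: "\<i> * z = of_real (of_int n * pi)"
    unfolding sin_eq_0 by (metis Ints_cases)
  have "Re (\<i> * z) = of_int n * pi" "Im (\<i> * z) = 0"
    unfolding n by auto
  then have "Im z = - of_int n * pi" "Re z = 0"
    by auto
  with assms(1) have "\<bar>of_int n :: real\<bar> < 1"
    by (simp add: abs_mult)
  then have "n = 0"
    by linarith
  with n show ?thesis
    by simp
qed

text \<open>Reverse triangle inequality, as the norm of \<open>exp z\<close> is the exponential of
  \<open>Re z\<close>. It makes the strip integrand decay along the real direction.\<close>

lemma norm_sinh_ge: "norm (sinh z) \<ge> sinh \<bar>Re z\<bar>"
proof -
  have "norm (exp z) - norm (exp (- z)) \<le> norm (exp z - exp (- z))"
       "norm (exp (- z)) - norm (exp z) \<le> norm (exp z - exp (- z))"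
    using norm_triangle_ineq2[of "exp z" "exp (-z)"] norm_triangle_ineq2[of "exp (-z)" "exp z"]
    by (simp_all add: norm_minus_commute)
  then show ?thesis
    by (auto simp: sinh_field_def norm_divide abs_if)
qed

text \<open>The value \<open>4\<close> at \<open>0\<close> removes the singularity.\<close>

definition zcsch4 :: "complex \<Rightarrow> complex" where
  "zcsch4 z = (if z = 0 then 4 else z / sinh (z / 4))"

text \<open>The singularity at 0 is removable because \<open>sinh (z / 4) / z\<close> tends to 1/4.
  The next zeros of the denominator are at height 4 pi, so the lines at height 2 pi and -2 pi lie
  well inside the strip.\<close>

lemma holomorphic_zcsch4: "zcsch4 holomorphic_on {z. \<bar>Im z\<bar> < 4 * pi}"
proof -
  define S where "S = {z. \<bar>Im z\<bar> < 4 * pi}"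
  have op: "open S"
    unfolding S_def by (intro open_Collect_less continuous_intros)
  have nz: "sinh (z / 4) \<noteq> 0" if "z \<in> S" "z \<noteq> 0" for z
    using sinh_complex_zero[of "z / 4"] that by (auto simp: S_def)
  have "zcsch4 holomorphic_on S"
  proof (rule no_isolated_singularity'[where K = "{0}"])
    have "((\<lambda>z. sinh (z / 4)) has_field_derivative 1 / 4) (at (0 :: complex))"
      by (auto intro!: derivative_eq_intros)
    then have "((\<lambda>z. (sinh (z / 4) :: complex) / z) \<longlongrightarrow> 1 / 4) (at 0)"
      by (simp add: has_field_derivative_iff)
    then have "((\<lambda>z. inverse ((sinh (z / 4) :: complex) / z)) \<longlongrightarrow> inverse (1 / 4)) (at 0)"
      by (intro tendsto_inverse) auto
    moreover have "\<forall>\<^sub>F z in at 0. inverse ((sinh (z / 4) :: complex) / z) = zcsch4 z"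
      by (auto simp: eventually_at_filter zcsch4_def)
    ultimately have "(zcsch4 \<longlongrightarrow> inverse (1 / 4)) (at 0)"
      by (rule Lim_transform_eventually)
    moreover have "zcsch4 0 = inverse (1 / 4)"
      by (simp add: zcsch4_def)
    ultimately show "(zcsch4 \<longlongrightarrow> zcsch4 z) (at z within S)" if "z \<in> {0}" for z
      using that by (auto intro: tendsto_within_subset)
    have "(\<lambda>z. z / sinh (z / 4)) holomorphic_on S - {0}"
      unfolding sinh_field_def
      by (intro holomorphic_intros) (use nz in \<open>auto simp: sinh_field_def\<close>)
    then show "zcsch4 holomorphic_on S - {0}"
      by (rule holomorphic_transform) (auto simp: zcsch4_def)
  qed (use op in auto)
  then show ?thesis
    by (simp add: S_def)
qed

text \<open>A quarter of the shift 2 pi i is pi i / 2, which turns \<open>sinh\<close> into i times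
  \<open>cosh\<close>, or -i times it for the opposite shift.\<close>

lemma zcsch4_shift:
  "zcsch4 (of_real u + 2 * of_real pi * \<i>) = - \<i> * (of_real u + 2 * of_real pi * \<i>) * of_real (sech4 u)"
  "zcsch4 (of_real u - 2 * of_real pi * \<i>) = \<i> * (of_real u - 2 * of_real pi * \<i>) * of_real (sech4 u)"
proof -
  have e: "exp (complex_of_real pi * \<i> / 2) = \<i>" "exp (- (complex_of_real pi * \<i> / 2)) = - \<i>"
    using cis_pi_half by (simp_all add: cis_conv_exp mult.commute exp_minus)
  have c: "complex_of_real (cosh (u / 4)) = (exp (of_real u / 4) + exp (- (of_real u / 4))) / 2"
    by (simp add: cosh_field_def exp_of_real[symmetric])
  have 1: "sinh ((of_real u + 2 * of_real pi * \<i>) / 4) = \<i> * of_real (cosh (u / 4))"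
  proof -
    have *: "(of_real u + 2 * of_real pi * \<i>) / 4 = of_real u / 4 + complex_of_real pi * \<i> / 2"
      by (simp add: field_simps)
    show ?thesis
      unfolding * c sinh_field_def minus_add_distrib exp_add e by (simp add: algebra_simps)
  qed
  have 2: "sinh ((of_real u - 2 * of_real pi * \<i>) / 4) = - \<i> * of_real (cosh (u / 4))"
  proof -
    have *: "(of_real u - 2 * of_real pi * \<i>) / 4 = of_real u / 4 + (- (complex_of_real pi * \<i> / 2))"
      by (simp add: field_simps)
    show ?thesis
      unfolding * c sinh_field_def minus_add_distrib minus_minus exp_add e by (simp add: algebra_simps)
  qed
  have nz: "of_real u + 2 * of_real pi * \<i> \<noteq> 0" "of_real u - 2 * of_real pi * \<i> \<noteq> 0"
    by (auto simp: complex_eq_iff)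
  have c0: "complex_of_real (cosh (u / 4)) \<noteq> 0"
    by (simp add: of_real_eq_0_iff)
  show "zcsch4 (of_real u + 2 * of_real pi * \<i>) = - \<i> * (of_real u + 2 * of_real pi * \<i>) * of_real (sech4 u)"
    "zcsch4 (of_real u - 2 * of_real pi * \<i>) = \<i> * (of_real u - 2 * of_real pi * \<i>) * of_real (sech4 u)"
    using nz c0 by (simp_all only: zcsch4_def 1 2 if_False sech4_def) (simp_all add: field_simps)
qed

text \<open>The two points are the ends of a vertical segment of length 4 pi, on which the
  derivative of \<open>G\<close> is at most a polynomial over \<open>sinh (u / 4)\<close>. The sign
  \<open>s\<close> treats both ends of the strip at once.\<close>

lemma strip_difference_tendsto:
  fixes p :: "complex poly" and G :: "complex \<Rightarrow> complex" and s :: real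
  assumes G: "\<And>z. \<bar>Im z\<bar> < 4 * pi \<Longrightarrow> (G has_field_derivative zcsch4 z * poly p z) (at z)"
    and s: "\<bar>s\<bar> = 1"
  shows "((\<lambda>u. G (of_real (s * u) + 2 * of_real pi * \<i>) - G (of_real (s * u) - 2 * of_real pi * \<i>)) \<longlongrightarrow> 0) at_top"
proof -
  \<comment> \<open>On the segment the norm of \<open>z\<close> is at most
    \<open>u + 2 * pi\<close>. The exponent is \<open>Suc i\<close> because \<open>zcsch4\<close>
    contributes one more factor \<open>z\<close>.\<close>
  define B where "B = (\<lambda>u::real. (\<Sum>i\<le>degree p. norm (coeff p i) * ((u + 2 * pi) ^ Suc i / sinh (u / 4))))"
  have "((\<lambda>u::real. (u + 2 * pi) ^ Suc i / sinh (u / 4)) \<longlongrightarrow> 0) at_top" for i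
    unfolding sinh_field_def by real_asymp
  then have "(B \<longlongrightarrow> (\<Sum>i\<le>degree p. norm (coeff p i) * 0)) at_top"
    unfolding B_def by (intro tendsto_intros)
  then have "((\<lambda>u. B u * (4 * pi)) \<longlongrightarrow> 0 * (4 * pi)) at_top"
    by (intro tendsto_intros) auto
  then have lim: "((\<lambda>u. B u * (4 * pi)) \<longlongrightarrow> 0) at_top"
    by simp
  have "norm (G (of_real (s * u) + 2 * of_real pi * \<i>) - G (of_real (s * u) - 2 * of_real pi * \<i>)) \<le> B u * (4 * pi)"
    if u: "u > 0" for u
  proof -
    define a where "a = of_real (s * u) - 2 * of_real pi * \<i>"
    define b where "b = of_real (s * u) + 2 * of_real pi * \<i>"
    have seg: "Re z = s * u \<and> \<bar>Im z\<bar> \<le> 2 * pi" if "z \<in> closed_segment a b" for z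
    proof -
      obtain t where t: "0 \<le> t" "t \<le> 1" "z = (1 - t) *\<^sub>R a + t *\<^sub>R b"
        using \<open>z \<in> closed_segment a b\<close> by (auto simp: in_segment)
      have "Re z = s * u" "Im z = 2 * pi * (2 * t - 1)"
        by (simp_all add: t(3) a_def b_def algebra_simps)
      moreover have "\<bar>2 * pi * (2 * t - 1)\<bar> \<le> 2 * pi"
        using t(1,2) by (simp add: abs_mult)
      ultimately show ?thesis
        by simp
    qed
    have su: "\<bar>s * u\<bar> = u"
      using s u by (simp add: abs_mult)
    have bound: "norm (zcsch4 z * poly p z) \<le> B u" if "z \<in> closed_segment a b" for z
    proof -
      have z: "Re z = s * u" "\<bar>Im z\<bar> \<le> 2 * pi"
        using seg[OF that] by auto
      have nz: "norm z \<le> u + 2 * pi"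
        using cmod_le[of z] z su by simp
      have sh: "sinh (u / 4) \<le> norm (sinh (z / 4))" "sinh (u / 4) > 0"
        using norm_sinh_ge[of "z / 4"] z su u by simp_all
      have "z \<noteq> 0"
        using z(1) su u by auto
      then have "norm (zcsch4 z * poly p z) = norm (\<Sum>i\<le>degree p. coeff p i * (z ^ Suc i / sinh (z / 4)))"
        by (simp add: zcsch4_def poly_altdef sum_distrib_left mult_ac)
      also have "\<dots> \<le> (\<Sum>i\<le>degree p. norm (coeff p i) * ((u + 2 * pi) ^ Suc i / sinh (u / 4)))"
      proof (rule sum_norm_le)
        fix i
        have "norm z ^ Suc i / norm (sinh (z / 4)) \<le> (u + 2 * pi) ^ Suc i / sinh (u / 4)"
          using nz sh u by (intro frac_le power_mono) auto
        then show "norm (coeff p i * (z ^ Suc i / sinh (z / 4))) \<le> norm (coeff p i) * ((u + 2 * pi) ^ Suc i / sinh (u / 4))"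
          by (simp only: norm_mult norm_divide norm_power mult_left_mono norm_ge_zero)
      qed
      finally show ?thesis
        by (simp add: B_def)
    qed
    have "norm (G b - G a) \<le> B u * norm (b - a)"
    proof (rule field_differentiable_bound[of "closed_segment a b" G])
      show "(G has_field_derivative zcsch4 z * poly p z) (at z within closed_segment a b)" if "z \<in> closed_segment a b" for z
      proof -
        have "\<bar>Im z\<bar> < 4 * pi"
          using seg[OF that, THEN conjunct2] pi_gt_zero by linarith
        then show ?thesis
          by (rule has_field_derivative_at_within[OF G])
      qed
      show "norm (zcsch4 z * poly p z) \<le> B u" if "z \<in> closed_segment a b" for z
        by (rule bound[OF that])
    qed simp_all
    also have "b - a = of_real (4 * pi) * \<i>"
      by (simp add: a_def b_def)
    also have "norm (of_real (4 * pi) * \<i>) = 4 * pi"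
      by (simp only: norm_mult norm_of_real norm_ii) simp
    finally show ?thesis
      by (simp add: a_def b_def)
  qed
  then show ?thesis
    by (intro Lim_null_comparison[OF _ lim] eventually_mono[OF eventually_gt_at_top[of 0]]) auto
qed

text \<open>This is the \<open>S\<close> of the overview. The complex \<open>z\<close> enters only
  through the polynomial and \<open>u\<close> stays real, so the integral converges for every
  \<open>z\<close>.\<close>

definition sech_transform :: "complex poly \<Rightarrow> complex \<Rightarrow> complex" where
  "sech_transform p z = (LBINT u. poly p (z + of_real u) * of_real (sech4 u))"

text \<open>
  The integrand is the derivative of \<open>u \<mapsto> G (u + 2 \<pi> \<i>) - G (u - 2 \<pi> \<i>)\<close> up to a constant factor, where \<open>G\<close>
  is a primitive of \<open>zcsch4 z * poly p z\<close> on the strip; this difference vanishes at both ends.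
\<close>

lemma sech_transform_shift_0:
  "sech_transform (pCons 0 p) (2 * of_real pi * \<i>) + sech_transform (pCons 0 p) (- 2 * of_real pi * \<i>) = 0"
proof -
  define S where "S = {z. \<bar>Im z\<bar> < 4 * pi}"
  have S: "open S" "convex S"
  proof -
    show "open S"
      unfolding S_def by (intro open_Collect_less continuous_intros)
    have "S = {z. Im z < 4 * pi} \<inter> {z. Im z > - 4 * pi}"
      by (auto simp: S_def)
    then show "convex S"
      by (simp only: convex_Int convex_halfspace_Im_lt convex_halfspace_Im_gt)
  qed
  have "(\<lambda>z. zcsch4 z * poly p z) holomorphic_on S"
    using holomorphic_zcsch4 unfolding S_def by (intro holomorphic_intros)
  then obtain G where G': "\<And>z. z \<in> S \<Longrightarrow> (G has_field_derivative zcsch4 z * poly p z) (at z within S)"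
    using holomorphic_convex_primitive'[OF S(2,1)] by blast
  have G: "(G has_field_derivative zcsch4 z * poly p z) (at z)" if "\<bar>Im z\<bar> < 4 * pi" for z
  proof -
    have "z \<in> S"
      using that by (simp add: S_def)
    then show ?thesis
      using G'[of z] at_within_open[of z S] S(1) by simp
  qed
  define D where "D = (\<lambda>u. poly (pCons 0 p) (2 * of_real pi * \<i> + of_real u) * of_real (sech4 u)
      + poly (pCons 0 p) (- 2 * of_real pi * \<i> + of_real u) * of_real (sech4 u))"
  have intD: "integrable lborel D"
    unfolding D_def by (intro Bochner_Integration.integrable_add integrable_poly_sech4_shift)
  define \<Gamma> where "\<Gamma> = (\<lambda>u. G (of_real u + 2 * of_real pi * \<i>) - G (of_real u - 2 * of_real pi * \<i>))"
  have "(LBINT u=-\<infinity>..\<infinity>. - \<i> * D u) = 0 - 0"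
  proof (rule interval_integral_FTC_integrable)
    show "(\<Gamma> has_vector_derivative - \<i> * D u) (at u)" for u
    proof -
      have "(G has_field_derivative zcsch4 (of_real u + 2 * of_real pi * \<i>) * poly p (of_real u + 2 * of_real pi * \<i>))
              (at (of_real u + 2 * of_real pi * \<i>))"
           "(G has_field_derivative zcsch4 (of_real u - 2 * of_real pi * \<i>) * poly p (of_real u - 2 * of_real pi * \<i>))
              (at (of_real u - 2 * of_real pi * \<i>))"
        by (intro G; simp)+
      then have "((\<lambda>z. G (z + 2 * of_real pi * \<i>) - G (z - 2 * of_real pi * \<i>)) has_field_derivative
          zcsch4 (of_real u + 2 * of_real pi * \<i>) * poly p (of_real u + 2 * of_real pi * \<i>)
          - zcsch4 (of_real u - 2 * of_real pi * \<i>) * poly p (of_real u - 2 * of_real pi * \<i>)) (at (of_real u))"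
        by (auto intro!: derivative_eq_intros DERIV_chain2[of G])
      \<comment> \<open>The opposite signs in \<open>zcsch4_shift\<close> meet the minus sign of the
        difference, so both terms carry the same factor -i. The linear factor of
        \<open>zcsch4\<close> is the one that \<open>pCons 0 p\<close> has beyond
        \<open>p\<close>.\<close>
      also have "zcsch4 (of_real u + 2 * of_real pi * \<i>) * poly p (of_real u + 2 * of_real pi * \<i>)
          - zcsch4 (of_real u - 2 * of_real pi * \<i>) * poly p (of_real u - 2 * of_real pi * \<i>) = - \<i> * D u"
      proof -
        have comm: "2 * of_real pi * \<i> + of_real u = of_real u + 2 * of_real pi * \<i>"
          "- 2 * of_real pi * \<i> + of_real u = of_real u - 2 * of_real pi * \<i>"
          by simp_all
        show ?thesis
          unfolding D_def zcsch4_shift comm poly_pCons by algebra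
      qed
      finally show ?thesis
        unfolding \<Gamma>_def by (rule has_vector_derivative_real_field)
    qed
    show "isCont (\<lambda>u. - \<i> * D u) u" for u
      unfolding D_def sech4_def by (intro continuous_intros) auto
    show "set_integrable lborel (einterval (-\<infinity>) \<infinity>) (\<lambda>u. - \<i> * D u)"
      using intD by (simp add: set_integrable_def)
    have "((\<lambda>u. \<Gamma> (- u)) \<longlongrightarrow> 0) at_top" "(\<Gamma> \<longlongrightarrow> 0) at_top"
      using strip_difference_tendsto[OF G, of "-1"] strip_difference_tendsto[OF G, of 1]
      by (simp_all add: \<Gamma>_def)
    then show "((\<Gamma> \<circ> real_of_ereal) \<longlongrightarrow> 0) (at_right (-\<infinity>))" "((\<Gamma> \<circ> real_of_ereal) \<longlongrightarrow> 0) (at_left \<infinity>)"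
      by (simp_all add: ereal_tendsto_simps filterlim_at_bot_mirror)
  qed auto
  then have "(LBINT u. D u) = 0"
    by (simp add: interval_lebesgue_integral_def set_lebesgue_integral_def)
  then show ?thesis
    unfolding D_def sech_transform_def
    by (subst (asm) Bochner_Integration.integral_add) (intro integrable_poly_sech4_shift)+
qed

section \<open>Algebraic rules and polynomiality of the secant transform\<close>

lemma sech_transform_const: "sech_transform [:a:] z = 4 * of_real pi * a"
  using integral_sech4 by (simp add: sech_transform_def integral_complex_of_real)

lemma sech_transform_add: "sech_transform (p + q) z = sech_transform p z + sech_transform q z"
  unfolding sech_transform_def poly_add distrib_right
  by (intro Bochner_Integration.integral_add integrable_poly_sech4_shift)

lemma sech_transform_smult: "sech_transform (smult c p) z = c * sech_transform p z"
  by (simp add: sech_transform_def mult.assoc)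

lemma sech_transform_0 [simp]: "sech_transform 0 z = 0"
  by (simp add: sech_transform_def)

lemma sech_transform_translate: "sech_transform (pcompose p [:c, 1:]) z = sech_transform p (z + c)"
  by (simp add: sech_transform_def poly_pcompose add_ac)

text \<open>Translation reduces to \<open>z = 0\<close>. There the part of \<open>p\<close>
  divisible by the variable contributes 0, and the constant term contributes 4 pi times itself at
  each of the two points.\<close>

lemma sech_transform_shift:
  "sech_transform p (z + 2 * of_real pi * \<i>) + sech_transform p (z - 2 * of_real pi * \<i>) = 8 * of_real pi * poly p z"
proof -
  have 0: "sech_transform p (2 * of_real pi * \<i>) + sech_transform p (- 2 * of_real pi * \<i>) = 8 * of_real pi * poly p 0" for p
  proof (cases p)
    case (pCons a q)
    have "p = [:a:] + pCons 0 q"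
      by (simp add: pCons)
    then show ?thesis
      using sech_transform_shift_0[of q]
      by (simp only: sech_transform_add sech_transform_const) (simp add: algebra_simps)
  qed
  show ?thesis
    using 0[of "pcompose p [:z, 1:]"] by (simp add: sech_transform_translate poly_pcompose algebra_simps)
qed

text \<open>The weight \<open>u ^ k\<close> is what the induction on \<open>p\<close> needs.\<close>

lemma integral_power_sech4_polynomial:
  fixes p :: "complex poly"
  shows "\<exists>q. \<forall>z. poly q z = (LBINT u. poly p (z + of_real u) * (of_real u ^ k * of_real (sech4 u)))"
proof (induction p arbitrary: k)
  case 0
  then show ?case by (auto intro: exI[of _ 0])
next
  case (pCons a p)
  have int: "integrable lborel (\<lambda>u. poly p (z + of_real u) * (of_real u ^ k * of_real (sech4 u)))" for z :: complex and p k
    using integrable_poly_sech4[of "pcompose p [:z, 1:] * monom 1 k"]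
    by (simp add: poly_pcompose poly_monom mult.assoc)
  obtain q where q: "\<And>z. poly q z = (LBINT u. poly p (z + of_real u) * (of_real u ^ k * of_real (sech4 u)))"
    using pCons by blast
  obtain r where r: "\<And>z. poly r z = (LBINT u. poly p (z + of_real u) * (of_real u ^ Suc k * of_real (sech4 u)))"
    using pCons by blast
  show ?case
  proof (intro exI allI)
    fix z
    \<comment> \<open>The new factor \<open>z + u\<close> is split: its \<open>z\<close> stays
      outside the integral, and its \<open>u\<close> raises the weight from \<open>k\<close> to
      \<open>Suc k\<close>.\<close>
    have "(LBINT u. poly (pCons a p) (z + of_real u) * (of_real u ^ k * of_real (sech4 u)))
        = (LBINT u. poly [:a:] (z + of_real u) * (of_real u ^ k * of_real (sech4 u))
             + (z * (poly p (z + of_real u) * (of_real u ^ k * of_real (sech4 u)))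
             + poly p (z + of_real u) * (of_real u ^ Suc k * of_real (sech4 u))))"
      by (simp add: algebra_simps)
    also have "\<dots> = (LBINT u. poly [:a:] (z + of_real u) * (of_real u ^ k * of_real (sech4 u))) + (z * poly q z + poly r z)"
    proof -
      have 1: "integrable lborel (\<lambda>u. z * (poly p (z + of_real u) * (of_real u ^ k * of_real (sech4 u))))"
        and 2: "integrable lborel (\<lambda>u. z * (poly p (z + of_real u) * (of_real u ^ k * of_real (sech4 u)))
             + poly p (z + of_real u) * (of_real u ^ Suc k * of_real (sech4 u)))"
        by (intro Bochner_Integration.integrable_add integrable_mult_right int)+
      show ?thesis
        unfolding q r Bochner_Integration.integral_add[OF int 2] Bochner_Integration.integral_add[OF 1 int]
        by simp
    qed
    finally show "poly ([:(LBINT u. a * (of_real u ^ k * of_real (sech4 u))):] + (pCons 0 q + r)) z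
        = (LBINT u. poly (pCons a p) (z + of_real u) * (of_real u ^ k * of_real (sech4 u)))"
      by simp
  qed
qed

lemma sech_transform_polynomial: "\<exists>q. \<forall>z. poly q z = sech_transform p z"
  using integral_power_sech4_polynomial[of p 0] by (simp add: sech_transform_def)

section \<open>Half-line and double integrals against the kernel\<close>

lemma Hhat_sech4: "Hhat x y = (sech4 (x - y) - sech4 (x + y)) / 2"
  by (simp add: Hhat_def sech4_def)

lemma set_integrable_poly_Hhat:
  "set_integrable lborel {0..} (\<lambda>x. poly p (complex_of_real x) * complex_of_real (Hhat x y))"
proof -
  have "integrable lborel (\<lambda>x. poly p (complex_of_real x) * complex_of_real (sech4 (x - y)))" for y
    using lborel_integrable_real_affine[OF integrable_poly_sech4_shift[of p "of_real y"], of 1 "-y"]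
    by simp
  from this[of y] this[of "-y"]
  have "integrable lborel (\<lambda>x. (poly p (complex_of_real x) * complex_of_real (sech4 (x - y))
      - poly p (complex_of_real x) * complex_of_real (sech4 (x + y))) / 2)"
    by (intro integrable_divide_zero Bochner_Integration.integrable_diff) simp_all
  then show ?thesis
    unfolding set_integrable_def
    by (intro integrable_mult_indicator) (simp_all add: Hhat_sech4 algebra_simps diff_divide_distrib)
qed

text \<open>As \<open>p\<close> is odd and \<open>sech4\<close> is even, the second half of the
  kernel is the reflection of the first, and the two half-line integrals join to one over the whole
  line. In the boundary terms \<open>y\<close> is \<open>b - bs ! j\<close>, which can be
  negative.\<close>

lemma halfline_transform:
  assumes odd: "\<And>z. poly p (- z) = - poly p z"
  shows "(LBINT x:{0..}. poly p (of_real x) * of_real (Hhat x y)) = 1/2 * sech_transform p (of_real y)"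
proof -
  define f where "f = (\<lambda>x. poly p (complex_of_real x) * complex_of_real (sech4 (x - y)))"
  have int: "integrable lborel f"
    using lborel_integrable_real_affine[OF integrable_poly_sech4_shift[of p "of_real y"], of 1 "-y"]
    by (simp add: f_def)
  have f_shift: "(LBINT x. f x) = sech_transform p (of_real y)"
    using lborel_integral_real_affine[of 1 f y] by (simp add: f_def sech_transform_def)
  have int': "integrable lborel (\<lambda>x. f (- x))"
    using lborel_integrable_real_affine[OF int, of "-1" 0] by simp
  have "(LBINT x:{0..}. f (- x)) = (LBINT x:{..0}. f x)"
    using lborel_integral_real_affine[of "-1" "\<lambda>x. indicator {0..} x *\<^sub>R f (- x)" 0]
    by (simp add: set_lebesgue_integral_def indicator_def)
  \<comment> \<open>The point 0, a null set, is dropped so that the two half-lines become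
    disjoint.\<close>
  also have "\<dots> = (LBINT x:{..<0}. f x)"
    unfolding set_lebesgue_integral_def
    by (rule Bochner_Integration.integral_cong_AE)
       (use int AE_lborel_singleton[of "0::real"] in \<open>auto intro!: borel_measurable_scaleR
          dest: borel_measurable_integrable elim!: eventually_mono split: split_indicator\<close>)
  finally have "(LBINT x:{0..}. f x) + (LBINT x:{0..}. f (- x)) = (LBINT x:{0..}. f x) + (LBINT x:{..<0}. f x)"
    by simp
  also have "\<dots> = (LBINT x:{0..} \<union> {..<0}. f x)"
    using int by (intro set_integral_Un[symmetric])
      (auto simp: set_integrable_def intro!: integrable_mult_indicator)
  also have "{0..} \<union> {..<0} = (UNIV :: real set)"
    by auto
  finally have sum: "(LBINT x:{0..}. f x) + (LBINT x:{0..}. f (- x)) = (LBINT x. f x)"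
    by (simp add: set_lebesgue_integral_def)
  have si: "set_integrable lborel {0..} f" "set_integrable lborel {0..} (\<lambda>x. f (- x))"
    using int int' by (auto simp: set_integrable_def intro!: integrable_mult_indicator)
  have "poly p (of_real x) * of_real (Hhat x y) = 1/2 * (f x + f (- x))" for x
  proof -
    have "sech4 (- x - y) = sech4 (x + y)"
      using sech4_minus[of "x + y"] by (simp add: algebra_simps)
    then show ?thesis
      by (simp add: f_def odd Hhat_sech4 algebra_simps diff_divide_distrib)
  qed
  then have "(LBINT x:{0..}. poly p (of_real x) * of_real (Hhat x y)) = 1/2 * (LBINT x:{0..}. f x + f (- x))"
    by (simp only: set_integral_mult_right)
  also have "\<dots> = 1/2 * sech_transform p (of_real y)"
    using set_integral_add(2)[OF si] sum f_shift by simp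
  finally show ?thesis .
qed

section \<open>Double integrals in the coordinates x and z = x + y\<close>

text \<open>Both \<open>\<bar>z - b\<bar>\<close> and \<open>\<bar>z + b\<bar>\<close> are at least
  \<open>z - \<bar>b\<bar>\<close>. A bound by an exponential in \<open>z\<close> is wanted because
  it factors over z = x + y.\<close>

lemma norm_Hhat_le: "\<bar>Hhat z b\<bar> \<le> 2 * exp (\<bar>b\<bar> / 4) * exp (- z / 4)"
proof -
  have "2 * exp (- \<bar>z - b\<bar> / 4) \<le> 2 * exp (\<bar>b\<bar> / 4) * exp (- z / 4)"
    and "2 * exp (- \<bar>z + b\<bar> / 4) \<le> 2 * exp (\<bar>b\<bar> / 4) * exp (- z / 4)"
    unfolding mult.assoc exp_add[symmetric] by (intro mult_left_mono; simp add: abs_if field_simps)+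
  then have "sech4 (z - b) \<le> 2 * exp (\<bar>b\<bar> / 4) * exp (- z / 4)"
    and "sech4 (z + b) \<le> 2 * exp (\<bar>b\<bar> / 4) * exp (- z / 4)"
    using sech4_le[of "z - b"] sech4_le[of "z + b"] by linarith+
  moreover have "\<bar>(x - y) / 2\<bar> \<le> M" if "0 < x" "0 < y" "x \<le> M" "y \<le> M" for x y M :: real
    using that by (simp add: abs_le_iff)
  ultimately show ?thesis
    unfolding Hhat_sech4 using sech4_pos by blast
qed

lemma borel_measurable_Hhat [measurable]: "(\<lambda>z. Hhat z b) \<in> borel_measurable borel"
  unfolding Hhat_sech4 by measurable

lemma integrable_pair_convolution:
  fixes f g :: "real \<Rightarrow> real"
  assumes f: "integrable lborel f" and g: "integrable lborel g"
  shows "integrable (lborel \<Otimes>\<^sub>M lborel) (\<lambda>(x, z). f x * g (z - x))"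
proof (rule lborel_pair.Fubini_integrable)
  have [measurable]: "f \<in> borel_measurable borel" "g \<in> borel_measurable borel"
    using f g by (auto dest: borel_measurable_integrable)
  show "(\<lambda>(x, z). f x * g (z - x)) \<in> borel_measurable (lborel \<Otimes>\<^sub>M lborel)"
    by measurable
  have int: "integrable lborel (\<lambda>z. g (z - x))" for x
    using lborel_integrable_real_affine[OF g, of 1 "-x"] by simp
  then show "AE x in lborel. integrable lborel (\<lambda>z. case (x, z) of (x, z) \<Rightarrow> f x * g (z - x))"
    by simp
  have "(LBINT z. norm (f x * g (z - x))) = norm (f x) * (LBINT z. norm (g z))" for x
    using lborel_integral_real_affine[of 1 "\<lambda>z. norm (g z)" "-x"] by (simp add: abs_mult)
  then show "integrable lborel (\<lambda>x. LBINT z. norm (case (x, z) of (x, z) \<Rightarrow> f x * g (z - x)))"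
    using f by simp
qed

text \<open>The condition in the integrand is the quadrant of nonnegative x and y = z - x. There
  \<open>exp (- z / 4)\<close> splits into a factor in \<open>x\<close> and one in
  \<open>z - x\<close>, so \<open>integrable_pair_convolution\<close> gives the dominating
  function.\<close>

lemma integrable_monomial_Hhat:
  "integrable (lborel \<Otimes>\<^sub>M lborel) (\<lambda>(x, z). if 0 \<le> x \<and> x \<le> z
     then complex_of_real (x ^ k * (z - x) ^ l * Hhat z b) else 0)"
proof (rule Bochner_Integration.integrable_bound)
  define \<phi> :: "nat \<Rightarrow> real \<Rightarrow> real" where "\<phi> = (\<lambda>k x. \<bar>x\<bar> ^ k * exp (- \<bar>x\<bar> / 4))"
  have "integrable (lborel \<Otimes>\<^sub>M lborel) (\<lambda>(x, z). \<phi> k x * \<phi> l (z - x))"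
    unfolding \<phi>_def by (intro integrable_pair_convolution integrable_power_exp_abs)
  then show "integrable (lborel \<Otimes>\<^sub>M lborel) (\<lambda>p. 2 * exp (\<bar>b\<bar> / 4) * (case p of (x, z) \<Rightarrow> \<phi> k x * \<phi> l (z - x)))"
    by (rule integrable_mult_right)
  show "(\<lambda>(x, z). if 0 \<le> x \<and> x \<le> z then complex_of_real (x ^ k * (z - x) ^ l * Hhat z b) else 0)
     \<in> borel_measurable (lborel \<Otimes>\<^sub>M lborel)"
    by measurable
  have "\<bar>x ^ k * (z - x) ^ l * Hhat z b\<bar> \<le> 2 * exp (\<bar>b\<bar> / 4) * (\<phi> k x * \<phi> l (z - x))"
    if "0 \<le> x" "x \<le> z" for x z
  proof -
    have "\<bar>x ^ k * (z - x) ^ l * Hhat z b\<bar> = x ^ k * (z - x) ^ l * \<bar>Hhat z b\<bar>"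
      using that by (simp add: abs_mult)
    also have "\<dots> \<le> x ^ k * (z - x) ^ l * (2 * exp (\<bar>b\<bar> / 4) * exp (- z / 4))"
      using that by (intro mult_left_mono norm_Hhat_le) auto
    also have "exp (- z / 4) = exp (- x / 4) * exp (- (z - x) / 4)"
      by (simp add: field_simps flip: exp_add)
    moreover have "\<bar>x\<bar> = x" "\<bar>z - x\<bar> = z - x"
      using that by simp_all
    ultimately show ?thesis
      by (simp only: \<phi>_def mult_ac)
  qed
  moreover have "0 \<le> \<phi> i x" for i x
    by (simp add: \<phi>_def)
  ultimately show "AE p in lborel \<Otimes>\<^sub>M lborel.
     norm (case p of (x, z) \<Rightarrow> if 0 \<le> x \<and> x \<le> z then complex_of_real (x ^ k * (z - x) ^ l * Hhat z b) else 0)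
     \<le> norm (2 * exp (\<bar>b\<bar> / 4) * (case p of (x, z) \<Rightarrow> \<phi> k x * \<phi> l (z - x)))"
    by (intro AE_I2) (auto simp del: of_real_mult of_real_power simp: norm_of_real)
qed

text \<open>Substitution of b t for x: two factors \<open>b\<close> come from the weight
  \<open>x * (b - x)\<close> and one from dx. The right-hand side makes sense for complex
  \<open>b\<close> too, which exhibits the convolution as a polynomial in \<open>b\<close>. The
  degenerate substitution at \<open>b = 0\<close> is treated apart.\<close>

lemma convolution_scaling:
  fixes F :: "complex \<Rightarrow> complex \<Rightarrow> complex"
  assumes "0 \<le> b"
  shows "(LBINT x:{0..b}. of_real (x * (b - x)) * F (of_real x) (of_real (b - x)))
    = of_real b ^ 3 * (LBINT t:{0..1}. of_real (t * (1 - t)) * F (of_real b * of_real t) (of_real b * of_real (1 - t)))"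
proof (cases "b = 0")
  case True
  have "(\<lambda>x. indicator {0..b} x *\<^sub>R (complex_of_real (x * (b - x)) * F (of_real x) (of_real (b - x)))) = (\<lambda>x. 0)"
    using True by (auto simp: indicator_def)
  then show ?thesis
    using True by (simp add: set_lebesgue_integral_def)
next
  case False
  with assms have b: "b > 0"
    by simp
  define f where "f = (\<lambda>x. indicator {0..b} x *\<^sub>R (complex_of_real (x * (b - x)) * F (of_real x) (of_real (b - x))))"
  have "(LBINT x. f x) = of_real b * (LBINT t. f (b * t))"
    using lborel_integral_real_affine[of b f 0] b by (simp add: scaleR_conv_of_real)
  also have "(\<lambda>t. f (b * t)) = (\<lambda>t. of_real b ^ 2 *
      (indicator {0..1} t *\<^sub>R (of_real (t * (1 - t)) * F (of_real b * of_real t) (of_real b * of_real (1 - t)))))"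
  proof
    fix t
    have "indicator {0..b} (b * t) = (indicator {0..1} t :: real)"
      using b by (auto simp: indicator_def zero_le_mult_iff mult_le_cancel_left1)
    moreover have "b - b * t = b * (1 - t)"
      by (simp add: algebra_simps)
    ultimately show "f (b * t) = of_real b ^ 2 *
      (indicator {0..1} t *\<^sub>R (of_real (t * (1 - t)) * F (of_real b * of_real t) (of_real b * of_real (1 - t))))"
      unfolding f_def by (simp only: of_real_mult) (simp add: power2_eq_square del: of_real_diff)
  qed
  finally show ?thesis
    unfolding f_def set_lebesgue_integral_def integral_mult_right_zero
    by (simp only: power3_eq_cube power2_eq_square mult.assoc)
qed

text \<open>
  Relates a recursion term \<open>h\<close> to the corresponding term \<open>r\<close> of the theorem.  The relation is
  linear, so it can be checked term by term.
\<close>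

definition sech_related :: "(real \<Rightarrow> complex) \<Rightarrow> (real \<Rightarrow> complex) \<Rightarrow> bool" where
  "sech_related h r \<longleftrightarrow>
     (\<exists>P. \<forall>b\<ge>0. h b = 1/2 * sech_transform P (of_real b) \<and> r b = poly P (of_real b))"

lemma sech_relatedI:
  assumes "\<And>b. 0 \<le> b \<Longrightarrow> h b = 1/2 * sech_transform P (of_real b)"
    and "\<And>b. 0 \<le> b \<Longrightarrow> r b = poly P (of_real b)"
  shows "sech_related h r"
  using assms unfolding sech_related_def by blast

lemma sech_related_add:
  assumes "sech_related h r" "sech_related h' r'"
  shows "sech_related (\<lambda>b. h b + h' b) (\<lambda>b. r b + r' b)"
proof -
  from assms(1) obtain P where "\<And>b. 0 \<le> b \<Longrightarrow> h b = 1/2 * sech_transform P (of_real b) \<and> r b = poly P (of_real b)"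
    unfolding sech_related_def by blast
  moreover from assms(2) obtain Q where "\<And>b. 0 \<le> b \<Longrightarrow> h' b = 1/2 * sech_transform Q (of_real b) \<and> r' b = poly Q (of_real b)"
    unfolding sech_related_def by blast
  ultimately show ?thesis
    by (intro sech_relatedI[of _ "P + Q"]) (simp_all add: sech_transform_add)
qed

lemma sech_related_cmult:
  assumes "sech_related h r"
  shows "sech_related (\<lambda>b. c * h b) (\<lambda>b. c * r b)"
proof -
  from assms obtain P where "\<And>b. 0 \<le> b \<Longrightarrow> h b = 1/2 * sech_transform P (of_real b) \<and> r b = poly P (of_real b)"
    unfolding sech_related_def by blast
  then show ?thesis
    by (intro sech_relatedI[of _ "smult c P"]) (simp_all add: sech_transform_smult)
qed

lemma sech_related_sum:
  assumes "\<And>i. i \<in> I \<Longrightarrow> sech_related (h i) (r i)"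
  shows "sech_related (\<lambda>b. \<Sum>i\<in>I. h i b) (\<lambda>b. \<Sum>i\<in>I. r i b)"
  using assms
proof (induction I rule: infinite_finite_induct)
  case (insert i I)
  then show ?case
    by (simp add: sech_related_add)
qed (auto intro!: sech_relatedI[of _ 0])

text \<open>With z = x + y as inner variable, Fubini moves the kernel \<open>Hhat z b\<close>
  outside the integral over x, which leaves the convolution of the theorem at \<open>z\<close>. This
  is an odd polynomial in \<open>z\<close>, so \<open>halfline_transform\<close> finishes.\<close>

lemma sech_related_double_integral:
  fixes F :: "complex \<Rightarrow> complex \<Rightarrow> complex"
  assumes fin: "finite S"
    and F: "\<And>x y. F x y = (\<Sum>e\<in>S. c e * (x ^ k e * y ^ l e))"
    and even: "\<And>x y. F (- x) (- y) = F x y"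
  shows "sech_related
    (\<lambda>b. LBINT x:{0..}. LBINT y:{0..}. of_real (x * y) * F (of_real x) (of_real y) * of_real (Hhat (x + y) b))
    (\<lambda>b. LBINT x:{0..b}. of_real (x * (b - x)) * F (of_real x) (of_real (b - x)))"
proof -
  \<comment> \<open>The Beta integrals with parameters \<open>k e + 2\<close> and
    \<open>l e + 2\<close>. The 3 in the exponents of \<open>P\<close> is the power of
    \<open>b\<close> from \<open>convolution_scaling\<close>.\<close>
  define B where "B = (\<lambda>e. LBINT t:{0..1::real}. complex_of_real (t ^ Suc (k e) * (1 - t) ^ Suc (l e)))"
  define P where "P = (\<Sum>e\<in>S. monom (c e * B e) (k e + l e + 3))"
  have P: "poly P z = z ^ 3 * (LBINT t:{0..1}. of_real (t * (1 - t)) * F (z * of_real t) (z * of_real (1 - t)))" for z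
  proof -
    have si: "set_integrable lborel {0..1::real} (\<lambda>t. complex_of_real (t ^ Suc (k e) * (1 - t) ^ Suc (l e)))" for e
      by (intro borel_integrable_atLeastAtMost' continuous_intros)
    have "(LBINT t:{0..1}. of_real (t * (1 - t)) * F (z * of_real t) (z * of_real (1 - t)))
        = (LBINT t:{0..1::real}. (\<Sum>e\<in>S. c e * z ^ (k e + l e) * complex_of_real (t ^ Suc (k e) * (1 - t) ^ Suc (l e))))"
      unfolding F sum_distrib_left
      by (intro arg_cong[of _ _ "set_lebesgue_integral _ _"] ext sum.cong refl)
         (simp add: power_mult_distrib power_add mult_ac)
    also have "\<dots> = (\<Sum>e\<in>S. c e * z ^ (k e + l e) * B e)"
    proof -
      have "integrable lborel (\<lambda>t. indicator {0..1::real} t *\<^sub>R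
              (c e * z ^ (k e + l e) * complex_of_real (t ^ Suc (k e) * (1 - t) ^ Suc (l e))))" for e
        using set_integrable_mult_right[OF si] unfolding set_integrable_def .
      then show ?thesis
        unfolding B_def set_integral_mult_right[symmetric]
        unfolding set_lebesgue_integral_def scaleR_sum_right
        by (intro Bochner_Integration.integral_sum)
    qed
    finally show ?thesis
      by (simp add: P_def poly_sum poly_monom sum_distrib_left power_add mult_ac)
  qed
  \<comment> \<open>\<open>z ^ 3\<close> changes sign, while both arguments of \<open>F\<close>
    change sign together.\<close>
  have odd: "poly P (- z) = - poly P z" for z
    unfolding P by (simp add: even)
  have conv: "(LBINT x:{0..b}. of_real (x * (b - x)) * F (of_real x) (of_real (b - x))) = poly P (of_real b)" if "0 \<le> b" for b
    unfolding P by (rule convolution_scaling[OF that])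
  moreover have "(LBINT x:{0..}. LBINT y:{0..}. of_real (x * y) * F (of_real x) (of_real y) * of_real (Hhat (x + y) b))
        = 1/2 * sech_transform P (of_real b)" for b
  proof -
    define f where "f = (\<lambda>x z. if 0 \<le> x \<and> x \<le> z
      then complex_of_real (x * (z - x)) * F (of_real x) (of_real (z - x)) * of_real (Hhat z b) else 0)"
    have "integrable (lborel \<Otimes>\<^sub>M lborel) (\<lambda>p. \<Sum>e\<in>S. c e * (case p of (x, z) \<Rightarrow>
      if 0 \<le> x \<and> x \<le> z then complex_of_real (x ^ Suc (k e) * (z - x) ^ Suc (l e) * Hhat z b) else 0))"
      by (intro Bochner_Integration.integrable_sum integrable_mult_right integrable_monomial_Hhat)
    also have "(\<lambda>p. \<Sum>e\<in>S. c e * (case p of (x, z) \<Rightarrow>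
      if 0 \<le> x \<and> x \<le> z then complex_of_real (x ^ Suc (k e) * (z - x) ^ Suc (l e) * Hhat z b) else 0)) = case_prod f"
      by (auto simp: f_def F fun_eq_iff sum_distrib_left sum_distrib_right mult_ac intro!: sum.cong)
    finally have int: "integrable (lborel \<Otimes>\<^sub>M lborel) (case_prod f)" .
    \<comment> \<open>For fixed \<open>x\<close> the shift to \<open>y = z - x\<close> turns the
      cutoff \<open>x \<le> z\<close> into the half-line for \<open>y\<close>.\<close>
    have inner_left: "(LBINT z. f x z) = indicator {0..} x *\<^sub>R
       (LBINT y:{0..}. of_real (x * y) * F (of_real x) (of_real y) * of_real (Hhat (x + y) b))" for x
    proof -
      have "(LBINT z. f x z) = (LBINT y. f x (x + y))"
        using lborel_integral_real_affine[of 1 "f x" x] by simp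
      also have "(\<lambda>y. f x (x + y)) = (\<lambda>y. indicator {0..} x *\<^sub>R (indicator {0..} y *\<^sub>R
         (of_real (x * y) * F (of_real x) (of_real y) * of_real (Hhat (x + y) b))))"
        by (auto simp: f_def fun_eq_iff indicator_def)
      finally show ?thesis
        by (simp only: set_lebesgue_integral_def integral_scaleR_right)
    qed
    have inner_right: "(LBINT x. f x z) = indicator {0..} z *\<^sub>R (poly P (of_real z) * of_real (Hhat z b))" for z
    proof (cases "z \<ge> 0")
      case True
      have "(\<lambda>x. f x z) = (\<lambda>x. indicator {0..z} x *\<^sub>R (of_real (x * (z - x)) * F (of_real x) (of_real (z - x))) * of_real (Hhat z b))"
        by (auto simp: f_def fun_eq_iff indicator_def)
      then have "(LBINT x. f x z) = (LBINT x:{0..z}. of_real (x * (z - x)) * F (of_real x) (of_real (z - x))) * of_real (Hhat z b)"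
        by (simp only: set_lebesgue_integral_def integral_mult_left_zero)
      then show ?thesis
        unfolding conv[OF True] using True by simp
    next
      case False
      then have "(\<lambda>x. f x z) = (\<lambda>x. 0)"
        by (auto simp: f_def fun_eq_iff)
      with False show ?thesis
        by simp
    qed
    have "(LBINT x:{0..}. LBINT y:{0..}. of_real (x * y) * F (of_real x) (of_real y) * of_real (Hhat (x + y) b))
      = (LBINT x. LBINT z. f x z)"
      unfolding inner_left by (simp add: set_lebesgue_integral_def)
    also have "\<dots> = (LBINT z. LBINT x. f x z)"
      by (rule lborel_pair.Fubini_integral[OF int, symmetric])
    also have "\<dots> = (LBINT z:{0..}. poly P (of_real z) * of_real (Hhat z b))"
      unfolding inner_right by (simp add: set_lebesgue_integral_def)
    also have "\<dots> = 1/2 * sech_transform P (of_real b)"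
      by (rule halfline_transform[OF odd])
    finally show ?thesis .
  qed
  ultimately show ?thesis
    by (intro sech_relatedI[of _ P])
qed

section \<open>The recursion terms as secant transforms\<close>

lemma polynomial_fun_expand_last:
  assumes "polynomial_fun n f" "n = length us + length ws"
  obtains S :: "nat list set" and c where "finite S"
    "\<And>vs. length vs = length us \<Longrightarrow> f (vs @ ws) = (\<Sum>e\<in>S. c e * (\<Prod>i<length us. vs ! i ^ (e ! i)))"
proof -
  from assms obtain S :: "nat list set" and c where S: "finite S"
    and f: "\<And>xs. length xs = n \<Longrightarrow> f xs = (\<Sum>e\<in>S. c e * (\<Prod>i<n. xs ! i ^ (e ! i)))"
    unfolding polynomial_fun_def by blast
  have "f (vs @ ws) = (\<Sum>e\<in>S. (c e * (\<Prod>i\<in>{length us..<n}. ws ! (i - length us) ^ (e ! i))) * (\<Prod>i<length us. vs ! i ^ (e ! i)))"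
    if "length vs = length us" for vs
  proof -
    have "(\<Prod>i<n. (vs @ ws) ! i ^ (e ! i))
        = (\<Prod>i<length us. vs ! i ^ (e ! i)) * (\<Prod>i\<in>{length us..<n}. ws ! (i - length us) ^ (e ! i))" for e
    proof -
      have split: "{..<n} = {..<length us} \<union> {length us..<n}"
        using assms(2) by auto
      show ?thesis
        unfolding split using that by (subst prod.union_disjoint) (auto simp: nth_append intro!: arg_cong2[of _ _ _ _ "(*)"] prod.cong)
    qed
    then show ?thesis
      using f[of "vs @ ws"] that assms(2) by (simp add: mult_ac)
  qed
  with S show ?thesis
    by (rule that)
qed

text \<open>A nonzero polynomial has finitely many roots. This carries an identity from real lengths
  to complex arguments.\<close>

lemma poly_eq_0_halfline:
  fixes p :: "complex poly"
  assumes "\<And>x. 0 \<le> x \<Longrightarrow> poly p (of_real x) = 0"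
  shows "p = 0"
proof (rule ccontr)
  assume "p \<noteq> 0"
  then have "finite {z. poly p z = 0}"
    by (rule poly_roots_finite)
  moreover have "complex_of_real ` {0..} \<subseteq> {z. poly p z = 0}"
    using assms by auto
  ultimately have "finite (complex_of_real ` {0..})"
    by (rule finite_subset[rotated])
  then show False
    by (simp add: finite_image_iff inj_on_def infinite_Ici)
qed

context super_volumes
begin

lemma stable_or_zero:
  "V g (x # ws) = 0" if "\<not> (0 \<le> g \<and> 2 * g - 2 + int (Suc (length ws)) \<ge> 1)"
  using that by (intro unstable) auto

text \<open>Outside the stable range the zero polynomial serves, so that the terms of the recursion
  can be treated without a case distinction.\<close>

lemma V_first_polynomial:
  obtains p where "\<And>z. V g (z # ws) = poly p z" "\<And>z. poly p (- z) = poly p z"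
proof (cases "0 \<le> g \<and> 2 * g - 2 + int (Suc (length ws)) \<ge> 1")
  case True
  let ?n = "Suc (length ws)"
  have pf: "polynomial_fun ?n (V g)" and ev: "even_fun ?n (V g)"
    using True by (auto intro!: polynomial even)
  obtain S :: "nat list set" and c where S: "finite S"
    "\<And>vs. length vs = length [0::nat] \<Longrightarrow> V g (vs @ ws) = (\<Sum>e\<in>S. c e * (\<Prod>i<length [0::nat]. vs ! i ^ (e ! i)))"
    using polynomial_fun_expand_last[OF pf, of "[0::nat]" ws] by auto
  define p where "p = (\<Sum>e\<in>S. monom (c e) (e ! 0))"
  have p: "V g (z # ws) = poly p z" for z
    using S(2)[of "[z]"] by (simp add: p_def poly_sum poly_monom)
  have "poly p (- z) = poly p z" for z
  proof -
    have "V g ((z # ws)[0 := - ((z # ws) ! 0)]) = V g (z # ws)"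
      using ev unfolding even_fun_def by (metis length_Cons zero_less_Suc)
    then show ?thesis
      by (simp add: p)
  qed
  with p show ?thesis
    by (rule that)
next
  case False
  then show ?thesis
    using that[of 0] stable_or_zero by simp
qed

text \<open>Evenness is applied to the two variables in turn; the joint sign change is the form that
  \<open>sech_related_double_integral\<close> asks for.\<close>

lemma V_first_two_polynomial:
  obtains S :: "nat list set" and c where "finite S"
    "\<And>x y. V g (x # y # ws) = (\<Sum>e\<in>S. c e * (x ^ (e ! 0) * y ^ (e ! 1)))"
    "\<And>x y. V g ((- x) # (- y) # ws) = V g (x # y # ws)"
proof (cases "0 \<le> g \<and> 2 * g - 2 + int (Suc (Suc (length ws))) \<ge> 1")
  case True
  let ?n = "Suc (Suc (length ws))"
  have pf: "polynomial_fun ?n (V g)" and ev: "even_fun ?n (V g)"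
    using True by (auto intro!: polynomial even)
  obtain S :: "nat list set" and c where S: "finite S"
    "\<And>vs. length vs = length [0::nat, 0] \<Longrightarrow> V g (vs @ ws) = (\<Sum>e\<in>S. c e * (\<Prod>i<length [0::nat, 0]. vs ! i ^ (e ! i)))"
    using polynomial_fun_expand_last[OF pf, of "[0::nat, 0]" ws] by auto
  have "V g (x # y # ws) = (\<Sum>e\<in>S. c e * (x ^ (e ! 0) * y ^ (e ! 1)))" for x y
    using S(2)[of "[x, y]"] by (simp add: numeral_2_eq_2)
  moreover have "V g ((- x) # (- y) # ws) = V g (x # y # ws)" for x y
  proof -
    have flip: "V g (xs[i := - (xs ! i)]) = V g xs" if "length xs = ?n" "i < ?n" for xs i
      using ev that unfolding even_fun_def by blast
    show ?thesis
      using flip[of "x # y # ws" 0] flip[of "(- x) # y # ws" 1] by simp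
  qed
  ultimately show ?thesis
    using that S(1) by blast
next
  case False
  then show ?thesis
    using that[of "{}" undefined] stable_or_zero[of g "_ # ws"] by simp
qed

lemma sech_related_nonseparating:
  "sech_related
    (\<lambda>b. LBINT x:{0..}. LBINT y:{0..}. of_real (x * y) * V g (map of_real (x # y # bs)) * of_real (Hhat (x + y) b))
    (\<lambda>b. LBINT x:{0..b}. of_real (x * (b - x)) * V g (map of_real (x # (b - x) # bs)))"
proof -
  obtain S :: "nat list set" and c where S: "finite S"
    "\<And>x y. V g (x # y # map of_real bs) = (\<Sum>e\<in>S. c e * (x ^ (e ! 0) * y ^ (e ! 1)))"
    "\<And>x y. V g ((- x) # (- y) # map of_real bs) = V g (x # y # map of_real bs)"
    using V_first_two_polynomial[of g "map of_real bs"] by blast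
  show ?thesis
    using sech_related_double_integral[of S "\<lambda>x y. V g (x # y # map of_real bs)", OF S]
    by (simp only: list.map)
qed

lemma sech_related_separating:
  "sech_related
    (\<lambda>b. LBINT x:{0..}. LBINT y:{0..}. of_real (x * y) * V g (map of_real (x # us)) * V h (map of_real (y # vs)) * of_real (Hhat (x + y) b))
    (\<lambda>b. LBINT x:{0..b}. of_real (x * (b - x)) * V g (map of_real (x # us)) * V h (map of_real ((b - x) # vs)))"
proof -
  obtain p where p: "\<And>z. V g (z # map of_real us) = poly p z" "\<And>z. poly p (- z) = poly p z"
    using V_first_polynomial[of g "map of_real us"] by blast
  obtain q where q: "\<And>z. V h (z # map of_real vs) = poly q z" "\<And>z. poly q (- z) = poly q z"
    using V_first_polynomial[of h "map of_real vs"] by blast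
  have "sech_related
    (\<lambda>b. LBINT x:{0..}. LBINT y:{0..}. of_real (x * y) * (poly p (of_real x) * poly q (of_real y)) * of_real (Hhat (x + y) b))
    (\<lambda>b. LBINT x:{0..b}. of_real (x * (b - x)) * (poly p (of_real x) * poly q (of_real (b - x))))"
  proof (rule sech_related_double_integral)
    show "poly p x * poly q y
      = (\<Sum>e\<in>{..degree p} \<times> {..degree q}. (coeff p (fst e) * coeff q (snd e)) * (x ^ fst e * y ^ snd e))" for x y
      by (simp add: poly_altdef sum_product sum.cartesian_product case_prod_beta mult_ac)
  qed (simp_all add: p(2) q(2))
  then show ?thesis
    by (simp only: list.map p(1) q(1) mult.assoc)
qed

text \<open>Each kernel gives half the transform of the odd polynomial \<open>q\<close> at
  \<open>b + t\<close> or \<open>b - t\<close>, that is, the transform at \<open>b\<close> of a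
  translate of \<open>q\<close>.\<close>

lemma sech_related_boundary:
  "sech_related
    (\<lambda>b. LBINT x:{0..}. of_real x * V g (map of_real (x # us)) * of_real (Hhat x (b + t) + Hhat x (b - t)))
    (\<lambda>b. of_real (b + t) * V g (map of_real ((b + t) # us)) + of_real (b - t) * V g (map of_real ((b - t) # us)))"
proof -
  obtain p where p: "\<And>z. V g (z # map of_real us) = poly p z" "\<And>z. poly p (- z) = poly p z"
    using V_first_polynomial[of g "map of_real us"] by blast
  define q where "q = pCons 0 p"
  have q: "poly q z = z * poly p z" for z
    by (simp add: q_def)
  have odd: "poly q (- z) = - poly q z" for z
    by (simp add: q p(2))
  define P where "P = pcompose q [:of_real t, 1:] + pcompose q [:- of_real t, 1:]"
  show ?thesis
  proof (rule sech_relatedI)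
    fix b
    have "(LBINT x:{0..}. of_real x * V g (map of_real (x # us)) * of_real (Hhat x (b + t) + Hhat x (b - t)))
        = (LBINT x:{0..}. poly q (of_real x) * of_real (Hhat x (b + t)) + poly q (of_real x) * of_real (Hhat x (b - t)))"
      by (simp only: list.map p(1) q of_real_add distrib_left)
    also have "\<dots> = 1/2 * sech_transform P (of_real b)"
      unfolding set_integral_add(2)[OF set_integrable_poly_Hhat set_integrable_poly_Hhat] halfline_transform[OF odd]
      by (simp add: P_def sech_transform_add sech_transform_translate)
    finally show "(LBINT x:{0..}. of_real x * V g (map of_real (x # us)) * of_real (Hhat x (b + t) + Hhat x (b - t)))
      = 1/2 * sech_transform P (of_real b)" .
    show "of_real (b + t) * V g (map of_real ((b + t) # us)) + of_real (b - t) * V g (map of_real ((b - t) # us))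
      = poly P (of_real b)"
      by (simp add: P_def poly_pcompose p(1) q add.commute)
  qed
qed

end

text \<open>The left side has the factor 1/2, where the English statement has -1/2. The positive
  sign is the one that fits the recursion: for \<open>g = 1\<close> and \<open>n = 2\<close> it
  gives \<open>V 1 [x, y] = 1/8\<close>, and both sides equal b/8.\<close>

theorem theorem1p4:
  fixes V :: "int \<Rightarrow> complex list \<Rightarrow> complex"
    and g :: int and n :: nat and b :: real and bs :: "real list"
  assumes "super_volumes V"
    and "0 \<le> g" and "1 \<le> n" and "2 * g - 2 + int n \<ge> 2"
    and "0 \<le> b" and "length bs = n - 1" and "\<forall>t\<in>set bs. 0 \<le> t"
  shows
    "1/2 * ((complex_of_real b + 2 * complex_of_real pi * \<i>)
              * V g ((complex_of_real b + 2 * complex_of_real pi * \<i>) # map complex_of_real bs)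
          + (complex_of_real b - 2 * complex_of_real pi * \<i>)
              * V g ((complex_of_real b - 2 * complex_of_real pi * \<i>) # map complex_of_real bs)) =
       1/2 * (LBINT x:{0..b}.
                complex_of_real (x * (b - x))
                * V (g - 1) (map complex_of_real (x # (b - x) # bs)))
     + 1/2 * (\<Sum>g1\<in>{0..g}. \<Sum>I\<in>Pow {..<n - 1}.
                LBINT x:{0..b}.
                  complex_of_real (x * (b - x))
                  * V g1 (map complex_of_real (x # nths bs I))
                  * V (g - g1) (map complex_of_real ((b - x) # nths bs (- I))))
     + 1/2 * (\<Sum>j<n - 1.
                complex_of_real (b + bs ! j)
                  * V g (map complex_of_real ((b + bs ! j) # nths bs (- {j})))
              + complex_of_real (b - bs ! j)
                  * V g (map complex_of_real ((b - bs ! j) # nths bs (- {j}))))"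
proof -
  interpret super_volumes V by fact
  let ?h = "\<lambda>b. 1/2 * (LBINT x:{0..}. LBINT y:{0..}.
        complex_of_real (x * y) * V (g - 1) (map complex_of_real (x # y # bs)) * complex_of_real (Hhat (x + y) b))
    + 1/2 * (\<Sum>g1\<in>{0..g}. \<Sum>I\<in>Pow {..<n - 1}.
        LBINT x:{0..}. LBINT y:{0..}. complex_of_real (x * y) * V g1 (map complex_of_real (x # nths bs I))
          * V (g - g1) (map complex_of_real (y # nths bs (- I))) * complex_of_real (Hhat (x + y) b))
    + 1/2 * (\<Sum>j<n - 1. LBINT x:{0..}. complex_of_real x * V g (map complex_of_real (x # nths bs (- {j})))
          * complex_of_real (Hhat x (b + bs ! j) + Hhat x (b - bs ! j)))"
  let ?r = "\<lambda>b. 1/2 * (LBINT x:{0..b}.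
        complex_of_real (x * (b - x)) * V (g - 1) (map complex_of_real (x # (b - x) # bs)))
    + 1/2 * (\<Sum>g1\<in>{0..g}. \<Sum>I\<in>Pow {..<n - 1}.
        LBINT x:{0..b}. complex_of_real (x * (b - x)) * V g1 (map complex_of_real (x # nths bs I))
          * V (g - g1) (map complex_of_real ((b - x) # nths bs (- I))))
    + 1/2 * (\<Sum>j<n - 1.
        complex_of_real (b + bs ! j) * V g (map complex_of_real ((b + bs ! j) # nths bs (- {j})))
        + complex_of_real (b - bs ! j) * V g (map complex_of_real ((b - bs ! j) # nths bs (- {j}))))"
  \<comment> \<open>The rules follow the shape of the two sums and build one polynomial
    \<open>P\<close> that serves all \<open>b \<ge> 0\<close>, with \<open>bs\<close> fixed.\<close>
  have "sech_related ?h ?r"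
    by (rule sech_related_add sech_related_cmult sech_related_sum
        sech_related_nonseparating sech_related_separating sech_related_boundary)+
  then obtain P where h: "\<And>b. 0 \<le> b \<Longrightarrow> ?h b = 1/2 * sech_transform P (of_real b)"
    and r: "\<And>b. 0 \<le> b \<Longrightarrow> ?r b = poly P (of_real b)"
    unfolding sech_related_def by blast
  obtain v where v: "\<And>z. V g (z # map complex_of_real bs) = poly v z"
    using V_first_polynomial[of g "map of_real bs"] by blast
  obtain s where s: "\<And>z. poly s z = sech_transform P z"
    using sech_transform_polynomial by blast
  have halfline: "2 * of_real pi * of_real x * V g (of_real x # map of_real bs) = 1/2 * sech_transform P (of_real x)" if "0 \<le> x" for x
    using trans[OF recursion[OF assms(2,3,4) that assms(6,7)] h[OF that]] by simp
  \<comment> \<open>The recursion is read as an equation between two polynomials in the first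
    length; it holds on the half-line and hence everywhere, in particular at the points shifted by 2
    pi i.\<close>
  have on_halfline: "poly (smult (2 * of_real pi) (pCons 0 v) - smult (1/2) s) (of_real x) = 0" if "0 \<le> x" for x
    using halfline[OF that] by (simp add: v s mult_ac)
  have "poly (smult (2 * of_real pi) (pCons 0 v) - smult (1/2) s) z = 0" for z
    using poly_eq_0_halfline[OF on_halfline] by simp
  then have eq: "z * V g (z # map of_real bs) = sech_transform P z / (4 * of_real pi)" for z
    by (simp add: v s field_simps)
  \<comment> \<open>The constants cancel: 1/2 from the left side, 1/(4 pi) from \<open>eq\<close>
    and 8 pi from \<open>sech_transform_shift\<close> multiply to 1.\<close>
  have "1/2 * ((of_real b + 2 * of_real pi * \<i>) * V g ((of_real b + 2 * of_real pi * \<i>) # map of_real bs)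
          + (of_real b - 2 * of_real pi * \<i>) * V g ((of_real b - 2 * of_real pi * \<i>) # map of_real bs))
      = poly P (of_real b)"
    using sech_transform_shift[of P "of_real b"]
    by (simp only: eq add_divide_distrib[symmetric]) simp
  also have "\<dots> = ?r b"
    by (rule r[OF \<open>0 \<le> b\<close>, symmetric])
  finally show ?thesis .
qed

end
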